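(* Let $\alpha,\beta\in(0,1]$, $\mu=1-\alpha$, $\nu=1-\beta$, $A,B\in\mathbb{R}$, and let $L=L(t,u,v,w):\mathbb{T}^\kappa\times\mathbb{R}\times\mathbb{R}\times\mathbb{R}\to\mathbb{R}$ be a function whose second-order partial derivatives $L_{uu},L_{uv},L_{uw},L_{vw},L_{vv},L_{ww}$ exist and are continuous. Let (P) be the problem of minimizing $$\mathcal{L}(y)=\sum_{t=a}^{b-1}L\bigl(t,y^{\sigma}(t),{}_a\Delta_t^\alpha y(t),{}_t\Delta_b^\beta y(t)\bigr)$$ over $y\in\mathcal{F}$ subject to $y(a)=A$ and $y(b)=B$. If $\tilde y\in\mathcal{F}$ is a local minimizer for problem (P), then for all $t\in\mathbb{T}^{\kappa^2}$ $$\begin{aligned} &L_{uu}[\tilde y](t)+2L_{uv}[\tilde y](t)+L_{vv}[\tilde y](t)+L_{vv}[\tilde y](\sigma(t))(\mu-1)^2\\ &+\sum_{s=\sigma(\sigma(t))}^{b-1}L_{vv}[\tilde y](s)\left(\frac{\mu(\mu-1)\prod_{i=0}^{s-t-3}(\mu+i+1)}{(s-t)\Gamma(s-t)}\right)^2+2L_{uw}[\tilde y](t)(\nu-1)\\ &+2(\nu-1)L_{vw}[\tilde y](t)+2(\mu-1)L_{vw}[\tilde y](\sigma(t))+L_{ww}[\tilde y](t)(1-\nu)^2+L_{ww}[\tilde y](\sigma(t))\\ &+\sum_{s=a}^{t-1}L_{ww}[\tilde y](s)\left(\frac{\nu(1-\nu)\prod_{i=0}^{t-s-2}(\nu+i+1)}{(\sigma(t)-s)\Gamma(\sigma(t)-s)}\right)^2\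 \ge\ 0, \end{aligned}$$ where $[\tilde y](t)=\bigl(t,\tilde y^{\sigma}(t),{}_a\Delta_t^\alpha\tilde y(t),{}_t\Delta_b^\beta\tilde y(t)\bigr)$.
   Context: Let $a\in\mathbb{R}$ and $b=a+k$ with $k\in\mathbb{N}$, $k\ge 2$. Put $\mathbb{T}=\{a,a+1,\ldots,b\}$, $\mathbb{T}^\kappa=\{a,\ldots,b-1\}$, $\mathbb{T}^{\kappa^2}=\{a,\ldots,b-2\}$; $\mathcal{F}$ is the set of real-valued functions on $\mathbb{T}$. Write $\sigma(t)=t+1$, $f^\sigma(t)=f(t+1)$, $\Delta f(t)=f(t+1)-f(t)$, and $x^{(y)}=\Gamma(x+1)/\Gamma(x+1-y)$. Empty sums are $0$ and empty products ($\prod_{i=0}^{-1}$) are $1$. All sums run over integer steps. Fractional sums of order $\nu\ge 0$: for $f\in\mathcal{F}$ and $t\in\mathbb{T}$, $${}_a\Delta_t^{-\nu}f(t)=f(t)+\frac{\nu}{\Gamma(\nu+1)}\sum_{s=a}^{t-1}(t+\nu-\sigma(s))^{(\nu-1)}f(s),$$ $${}_t\Delta_b^{-\nu}f(t)=f(t)+\frac{\nu}{\Gamma(\nu+1)}\sum_{s=t+1}^{b}(s+\nu-\sigma(t))^{(\nu-1)}f(s)$$ (so for $\nu=0$ both equal $f(t)$). Fractional differences: for $t\in\mathbb{T}^\kappa$ and order $\alpha\in(0,1]$, ${}_a\Delta_t^\alpha f(t)=\Delta({}_a\Delta_t^{-(1-\alpha)}f(t))$ and ${}_t\Delta_b^\alpha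 f(t)=-\Delta({}_t\Delta_b^{-(1-\alpha)}f(t))$, where the outer forward difference $\Delta$ acts in the variable $t$. Norm on $\mathcal{F}$: $\|f\|=\max_{t\in\mathbb{T}^\kappa}|f^\sigma(t)|+\max_{t\in\mathbb{T}^\kappa}|{}_a\Delta_t^\alpha f(t)|+\max_{t\in\mathbb{T}^\kappa}|{}_t\Delta_b^\beta f(t)|$. A function $\tilde y\in\mathcal{F}$ with $\tilde y(a)=A$, $\tilde y(b)=B$ is a local minimizer for (P) if there is $\delta>0$ such that $\mathcal{L}(\tilde y)\le\mathcal{L}(y)$ for all $y\in\mathcal{F}$ with $y(a)=A$, $y(b)=B$ and $\|y-\tilde y\|<\delta$. Subscripts $u,v,w$ on $L$ denote partial derivatives with respect to its second, third and fourth arguments, and $L_{uu}[\tilde y](t)$ means $L_{uu}$ evaluated at the point $[\tilde y](t)$, etc. *)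

theory Defs
  imports "HOL-Analysis.Analysis"
begin

(* The points x, x+1, x+2, ... that are at most y; empty if y < x. With b = a + k this gives
   T = steps a b, T^kappa = steps a (b - 1) and T^(kappa^2) = steps a (b - 2). Sums and products
   "over integer steps from x to y" range over steps x y, so empty ones are 0 and 1. *)
definition steps :: "real \<Rightarrow> real \<Rightarrow> real set" where
  "steps x y = {x + real n |n. x + real n \<le> y}"

abbreviation (input) jump :: "real \<Rightarrow> real" ("\<sigma>") where
  "\<sigma> t \<equiv> t + 1"

definition fdiff :: "(real \<Rightarrow> real) \<Rightarrow> real \<Rightarrow> real" where
  "fdiff f t = f (t + 1) - f t"

definition falling :: "real \<Rightarrow> real \<Rightarrow> real" where
  "falling x y = Gamma (x + 1) / Gamma (x + 1 - y)"

(* Elements of F, real functions on T, are represented by functions real => real; every notion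
   below uses only their values on T = steps a b, so the values elsewhere are irrelevant. *)

definition left_fsum :: "real \<Rightarrow> real \<Rightarrow> (real \<Rightarrow> real) \<Rightarrow> real \<Rightarrow> real" where
  "left_fsum a \<nu> f t =
     f t + \<nu> / Gamma (\<nu> + 1) * (\<Sum>s\<in>steps a (t - 1). falling (t + \<nu> - \<sigma> s) (\<nu> - 1) * f s)"

definition right_fsum :: "real \<Rightarrow> real \<Rightarrow> (real \<Rightarrow> real) \<Rightarrow> real \<Rightarrow> real" where
  "right_fsum b \<nu> f t =
     f t + \<nu> / Gamma (\<nu> + 1) * (\<Sum>s\<in>steps (t + 1) b. falling (s + \<nu> - \<sigma> t) (\<nu> - 1) * f s)"

definition left_fdiff :: "real \<Rightarrow> real \<Rightarrow> (real \<Rightarrow> real) \<Rightarrow> real \<Rightarrow> real" where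
  "left_fdiff a \<alpha> f t = fdiff (left_fsum a (1 - \<alpha>) f) t"

definition right_fdiff :: "real \<Rightarrow> real \<Rightarrow> (real \<Rightarrow> real) \<Rightarrow> real \<Rightarrow> real" where
  "right_fdiff b \<beta> f t = - fdiff (right_fsum b (1 - \<beta>) f) t"

definition fnorm :: "real \<Rightarrow> real \<Rightarrow> real \<Rightarrow> real \<Rightarrow> (real \<Rightarrow> real) \<Rightarrow> real" where
  "fnorm a b \<alpha> \<beta> f =
     (MAX t\<in>steps a (b - 1). \<bar>f (\<sigma> t)\<bar>)
     + (MAX t\<in>steps a (b - 1). \<bar>left_fdiff a \<alpha> f t\<bar>)
     + (MAX t\<in>steps a (b - 1). \<bar>right_fdiff b \<beta> f t\<bar>)"

type_synonym lagrangian = "real \<Rightarrow> real \<Rightarrow> real \<Rightarrow> real \<Rightarrow> real"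

(* at_traj a b alpha beta g y t is g[y](t), where
   [y](t) = (t, y(sigma t), left difference of y at t, right difference of y at t). *)
definition at_traj ::
  "real \<Rightarrow> real \<Rightarrow> real \<Rightarrow> real \<Rightarrow> lagrangian \<Rightarrow> (real \<Rightarrow> real) \<Rightarrow> real \<Rightarrow> real" where
  "at_traj a b \<alpha> \<beta> g y t = g t (y (\<sigma> t)) (left_fdiff a \<alpha> y t) (right_fdiff b \<beta> y t)"

definition functional ::
  "real \<Rightarrow> real \<Rightarrow> real \<Rightarrow> real \<Rightarrow> lagrangian \<Rightarrow> (real \<Rightarrow> real) \<Rightarrow> real" where
  "functional a b \<alpha> \<beta> L y = (\<Sum>t\<in>steps a (b - 1). at_traj a b \<alpha> \<beta> L y t)"

definition local_minimizer ::
  "real \<Rightarrow> real \<Rightarrow> real \<Rightarrow> real \<Rightarrow> lagrangian \<Rightarrow> real \<Rightarrow> real \<Rightarrow> (real \<Rightarrow> real) \<Rightarrow> bool" where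
  "local_minimizer a b \<alpha> \<beta> L A B yt \<longleftrightarrow>
     yt a = A \<and> yt b = B \<and>
     (\<exists>\<delta>>0. \<forall>y. y a = A \<longrightarrow> y b = B \<longrightarrow> fnorm a b \<alpha> \<beta> (\<lambda>t. y t - yt t) < \<delta> \<longrightarrow>
        functional a b \<alpha> \<beta> L yt \<le> functional a b \<alpha> \<beta> L y)"

definition pd_u :: "lagrangian \<Rightarrow> lagrangian" where
  "pd_u g t u v w = deriv (\<lambda>x. g t x v w) u"

definition pd_v :: "lagrangian \<Rightarrow> lagrangian" where
  "pd_v g t u v w = deriv (\<lambda>x. g t u x w) v"

definition pd_w :: "lagrangian \<Rightarrow> lagrangian" where
  "pd_w g t u v w = deriv (\<lambda>x. g t u v x) w"

definition has_pd_u :: "real set \<Rightarrow> lagrangian \<Rightarrow> bool" where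
  "has_pd_u T g \<longleftrightarrow> (\<forall>t\<in>T. \<forall>u v w. (\<lambda>x. g t x v w) field_differentiable at u)"

definition has_pd_v :: "real set \<Rightarrow> lagrangian \<Rightarrow> bool" where
  "has_pd_v T g \<longleftrightarrow> (\<forall>t\<in>T. \<forall>u v w. (\<lambda>x. g t u x w) field_differentiable at v)"

definition has_pd_w :: "real set \<Rightarrow> lagrangian \<Rightarrow> bool" where
  "has_pd_w T g \<longleftrightarrow> (\<forall>t\<in>T. \<forall>u v w. (\<lambda>x. g t u v x) field_differentiable at w)"

(* Mixed partials: L_uv = (L_u)_v, i.e. the first subscript is differentiated first. *)
abbreviation "pd_uu L \<equiv> pd_u (pd_u L)"
abbreviation "pd_uv L \<equiv> pd_v (pd_u L)"
abbreviation "pd_uw L \<equiv> pd_w (pd_u L)"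
abbreviation "pd_vv L \<equiv> pd_v (pd_v L)"
abbreviation "pd_vw L \<equiv> pd_w (pd_v L)"
abbreviation "pd_ww L \<equiv> pd_w (pd_w L)"

definition cont_lagr :: "real set \<Rightarrow> lagrangian \<Rightarrow> bool" where
  "cont_lagr T g \<longleftrightarrow> continuous_on (T \<times> UNIV) (\<lambda>(t, u, v, w). g t u v w)"

(* Existence of a second-order partial includes that of the first-order partial it is taken of;
   existence has to be required separately because deriv is a total operator. *)
definition cont_second_partials :: "real set \<Rightarrow> lagrangian \<Rightarrow> bool" where
  "cont_second_partials T L \<longleftrightarrow>
     has_pd_u T L \<and> has_pd_v T L \<and> has_pd_w T L \<and>
     has_pd_u T (pd_u L) \<and> has_pd_v T (pd_u L) \<and> has_pd_w T (pd_u L) \<and>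
     has_pd_w T (pd_v L) \<and> has_pd_v T (pd_v L) \<and> has_pd_w T (pd_w L) \<and>
     cont_lagr T (pd_uu L) \<and> cont_lagr T (pd_uv L) \<and> cont_lagr T (pd_uw L) \<and>
     cont_lagr T (pd_vw L) \<and> cont_lagr T (pd_vv L) \<and> cont_lagr T (pd_ww L)"

end

theory Submission
  imports Defs
begin

text \<open>The competitors are \<open>yt + h \<eta>\<close>, where \<open>\<eta>\<close> is the indicator of the interior point \<open>t + 1\<close>.
The fractional differences of \<open>\<eta>\<close> are increments of the binomial weights
\<open>\<nu>(\<nu> + 1)\<dots>(\<nu> + n - 1) / n!\<close>, and the second derivative in \<open>h\<close> of the functional, which is
nonnegative at \<open>h = 0\<close>, is exactly the claimed expression.  The symmetric second difference of the
functional is used in its place: it needs neither the Euler-Lagrange equation nor the symmetry of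
mixed partials.\<close>

section \<open>Integer steps as images of initial segments of the naturals\<close>

text \<open>The upper end is written through the number \<open>n\<close> of points, so that
  \<open>n = 0\<close> covers the empty range and no case distinction arises later.\<close>

lemma steps_eq: "steps x (x + real n - 1) = (\<lambda>i. x + real i) ` {..<n}"
proof -
  have "x + real i \<le> x + real n - 1 \<longleftrightarrow> i < n" for i
    by linarith
  then show ?thesis
    unfolding steps_def by auto
qed

lemma steps_conv:
  assumes "y = x + real n - 1"
  shows "steps x y = (\<lambda>i. x + real i) ` {..<n}"
  using assms steps_eq by simp

lemma sum_steps:
  assumes "y = x + real n - 1"
  shows "sum f (steps x y) = (\<Sum>i<n. f (x + real i))"
  unfolding steps_conv[OF assms] by (subst sum.reindex) (auto simp: inj_on_def)

lemma prod_steps: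
  assumes "y = x + real n - 1"
  shows "prod f (steps x y) = (\<Prod>i<n. f (x + real i))"
  unfolding steps_conv[OF assms] by (subst prod.reindex) (auto simp: inj_on_def)

section \<open>Linearity of the fractional differences and scaling of the norm\<close>

lemma left_fdiff_mult: "left_fdiff a \<alpha> (\<lambda>t. c * f t) t = c * left_fdiff a \<alpha> f t"
  unfolding left_fdiff_def fdiff_def left_fsum_def
  by (simp add: sum_distrib_left algebra_simps)

lemma right_fdiff_mult: "right_fdiff b \<beta> (\<lambda>t. c * f t) t = c * right_fdiff b \<beta> f t"
  unfolding right_fdiff_def fdiff_def right_fsum_def
  by (simp add: sum_distrib_left algebra_simps)

lemma left_fdiff_add:
  "left_fdiff a \<alpha> (\<lambda>t. f t + g t) t = left_fdiff a \<alpha> f t + left_fdiff a \<alpha> g t"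
  unfolding left_fdiff_def fdiff_def left_fsum_def
  by (simp add: sum.distrib algebra_simps)

lemma right_fdiff_add:
  "right_fdiff b \<beta> (\<lambda>t. f t + g t) t = right_fdiff b \<beta> f t + right_fdiff b \<beta> g t"
  unfolding right_fdiff_def fdiff_def right_fsum_def
  by (simp add: sum.distrib algebra_simps)

lemma Max_mult_left:
  fixes f :: "'a \<Rightarrow> real"
  assumes "finite S" "S \<noteq> {}" "0 \<le> c"
  shows "(MAX t\<in>S. c * f t) = c * (MAX t\<in>S. f t)"
proof -
  have "mono ((*) c)"
    using assms(3) by (auto simp: mono_def mult_left_mono)
  from mono_Max_commute[OF this, of "f ` S"] assms show ?thesis
    by (simp add: image_image)
qed

text \<open>This makes \<open>h * \<eta>\<close> a small variation for small \<open>h\<close>, which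
  is how the norm enters the argument.\<close>

lemma fnorm_mult:
  assumes "finite (steps a (b - 1))" "steps a (b - 1) \<noteq> {}"
  shows "fnorm a b \<alpha> \<beta> (\<lambda>t. c * f t) = \<bar>c\<bar> * fnorm a b \<alpha> \<beta> f"
  unfolding fnorm_def left_fdiff_mult right_fdiff_mult abs_mult
  using assms by (simp add: Max_mult_left distrib_left)

section \<open>Binomial weights and the fractional differences of an indicator\<close>

text \<open>This is the coefficient of \<open>x^n\<close> in the power series of
  \<open>(1 - x)^(-\<nu>)\<close>, that is, the kernel of the fractional sum of order \<nu>.\<close>

definition weight :: "real \<Rightarrow> nat \<Rightarrow> real" where
  "weight \<nu> n = pochhammer \<nu> n / fact n"

lemma weight_0 [simp]: "weight \<nu> 0 = 1"
  by (simp add: weight_def)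

text \<open>Splitting the factor \<nu> off \<open>pochhammer \<nu> (Suc n)\<close> leaves a Gamma
  quotient based at \<open>\<nu> + 1\<close>, which is positive; hence \<nu> = 0 is
  included.\<close>

lemma weight_falling:
  assumes "0 \<le> \<nu>"
  shows "\<nu> / Gamma (\<nu> + 1) * falling (real n + \<nu>) (\<nu> - 1) = weight \<nu> (Suc n)"
proof -
  have "\<nu> + 1 \<notin> \<int>\<^sub>\<le>\<^sub>0"
    using assms by (auto elim!: nonpos_Ints_cases)
  then have "pochhammer (\<nu> + 1) n = Gamma (\<nu> + 1 + real n) / Gamma (\<nu> + 1)"
    by (rule pochhammer_Gamma)
  moreover have "Gamma (real n + 2) = fact (Suc n)"
    using Gamma_fact[of "Suc n", where ?'a = real] by (simp add: add.commute)
  ultimately show ?thesis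
    unfolding falling_def weight_def pochhammer_rec
    by (simp add: add_ac)
qed

text \<open>Over the common denominator \<open>fact (Suc n)\<close> the factors
  \<open>\<nu> + n\<close> and \<open>n + 1\<close> differ by \<open>\<nu> - 1\<close>, whatever
  \<open>n\<close> is.\<close>

lemma weight_diff: "weight \<nu> (Suc n) - weight \<nu> n = (\<nu> - 1) * pochhammer \<nu> n / fact (Suc n)"
proof -
  have "pochhammer \<nu> (Suc n) = pochhammer \<nu> n * (\<nu> + real n)"
    by (simp add: pochhammer_Suc)
  moreover have "weight \<nu> n = pochhammer \<nu> n * real (Suc n) / fact (Suc n)"
    by (simp add: weight_def)
  ultimately have "weight \<nu> (Suc n) - weight \<nu> n
      = (pochhammer \<nu> n * (\<nu> + real n) - pochhammer \<nu> n * real (Suc n)) / fact (Suc n)"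
    unfolding weight_def[of \<nu> "Suc n"] by (simp only: diff_divide_distrib)
  also have "\<dots> = (\<nu> - 1) * pochhammer \<nu> n / fact (Suc n)"
    by (simp add: algebra_simps)
  finally show ?thesis .
qed

text \<open>This brings the increments into the shape used in the theorem. The variables
  \<open>d\<close> and \<open>x\<close> are tied to \<open>n\<close> by equations so that they can
  be matched with differences of points; for \<open>n = 0\<close> the product is empty.\<close>

lemma weight_diff_prod:
  assumes "d = real (Suc (Suc n))" "x = real n - 1"
  shows "weight \<nu> (Suc (Suc n)) - weight \<nu> (Suc n)
    = \<nu> * (\<nu> - 1) * (\<Prod>i\<in>steps 0 x. \<nu> + i + 1) / (d * Gamma d)"
proof -
  have "(\<Prod>i\<in>steps 0 x. \<nu> + i + 1) = pochhammer (\<nu> + 1) n"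
    using assms(2)
    by (subst prod_steps[where n = n]) (auto simp: pochhammer_prod atLeast0LessThan add_ac)
  moreover have "d * Gamma d = fact (Suc (Suc n))"
    using Gamma_fact[of "Suc n", where ?'a = real] assms(1) by (simp add: add_ac)
  ultimately show ?thesis
    unfolding weight_diff pochhammer_rec by (simp add: mult_ac)
qed

text \<open>Only the term at \<open>p\<close> survives: the separate summand \<open>f t\<close>
  supplies the weight of index 0, the kernel all later ones.\<close>

lemma left_fsum_indicator:
  assumes "0 \<le> \<mu>" and p: "p = a + real j"
  shows "left_fsum a \<mu> (\<lambda>s. if s = p then 1 else 0) (a + real i)
    = (if i < j then 0 else weight \<mu> (i - j))"
proof -
  have "(\<Sum>s\<in>steps a (a + real i - 1). falling (a + real i + \<mu> - \<sigma> s) (\<mu> - 1) * (if s = p then 1 else 0))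
     = (\<Sum>l<i. if l = j then falling (real i + \<mu> - 1 - real j) (\<mu> - 1) else 0)"
    unfolding p
    by (subst sum_steps[where n = i], simp, rule sum.cong) (auto simp: algebra_simps)
  also have "\<dots> = (if j < i then falling (real i + \<mu> - 1 - real j) (\<mu> - 1) else 0)"
    by simp
  finally have sum: "left_fsum a \<mu> (\<lambda>s. if s = p then 1 else 0) (a + real i)
    = (if i = j then 1 else 0)
      + \<mu> / Gamma (\<mu> + 1) * (if j < i then falling (real i + \<mu> - 1 - real j) (\<mu> - 1) else 0)"
    unfolding left_fsum_def p by simp
  show ?thesis
  proof (cases "j < i")
    case True
    then obtain n where n: "i = j + Suc n"
      by (auto dest: less_imp_Suc_add)
    then have eq: "real i + \<mu> - 1 - real j = real n + \<mu>" "i - j = Suc n"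
      by simp_all
    show ?thesis
      unfolding sum eq using True weight_falling[OF assms(1), of n] by simp
  qed (use sum in auto)
qed

text \<open>Mirror image of the left sum; \<open>j \<le> k\<close> keeps \<open>p\<close> inside the
  range, which ends at \<open>b\<close>.\<close>

lemma right_fsum_indicator:
  assumes "0 \<le> \<nu>" and p: "p = a + real j" and b: "b = a + real k" and "j \<le> k" "i \<le> k"
  shows "right_fsum b \<nu> (\<lambda>s. if s = p then 1 else 0) (a + real i)
    = (if j < i then 0 else weight \<nu> (j - i))"
proof -
  have "(\<Sum>s\<in>steps (a + real i + 1) b. falling (s + \<nu> - \<sigma> (a + real i)) (\<nu> - 1) * (if s = p then 1 else 0))
     = (\<Sum>l<k - i. if Suc (i + l) = j then falling (real l + \<nu>) (\<nu> - 1) else 0)"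
    unfolding p using assms(5)
    by (subst sum_steps[where n = "k - i"]) (auto intro!: sum.cong simp: b of_nat_diff algebra_simps)
  also have "\<dots> = (if i < j then falling (real (j - Suc i) + \<nu>) (\<nu> - 1) else 0)"
  proof (cases "i < j")
    case True
    \<comment> \<open>Solving the condition for \<open>l\<close> turns the sum into one over a
      single index, which lies below \<open>k - i\<close> because \<open>j \<le> k\<close>.\<close>
    have "(\<Sum>l<k - i. if Suc (i + l) = j then falling (real l + \<nu>) (\<nu> - 1) else 0)
      = (\<Sum>l<k - i. if l = j - Suc i then falling (real (j - Suc i) + \<nu>) (\<nu> - 1) else 0)"
      using True by (intro sum.cong) auto
    also have "\<dots> = falling (real (j - Suc i) + \<nu>) (\<nu> - 1)"
      using True assms(4) by simp
    finally show ?thesis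
      using True by simp
  qed (auto intro!: sum.neutral)
  finally have sum: "right_fsum b \<nu> (\<lambda>s. if s = p then 1 else 0) (a + real i)
    = (if i = j then 1 else 0)
      + \<nu> / Gamma (\<nu> + 1) * (if i < j then falling (real (j - Suc i) + \<nu>) (\<nu> - 1) else 0)"
    unfolding right_fsum_def p by simp
  show ?thesis
  proof (cases "i < j")
    case True
    then have "Suc (j - Suc i) = j - i"
      by simp
    with sum weight_falling[OF assms(1), of "j - Suc i"] True show ?thesis
      by simp
  qed (use sum in auto)
qed

text \<open>The middle case is the jump of the fractional sum from 0 to the weight of index
  0.\<close>

lemma left_fdiff_indicator:
  assumes "\<alpha> \<le> 1" "p = a + real j"
  shows "left_fdiff a \<alpha> (\<lambda>s. if s = p then 1 else 0) (a + real i)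
    = (if Suc i < j then 0 else if Suc i = j then 1
       else weight (1 - \<alpha>) (Suc (i - j)) - weight (1 - \<alpha>) (i - j))"
  using left_fsum_indicator[of "1 - \<alpha>" p a j i] left_fsum_indicator[of "1 - \<alpha>" p a j "Suc i"] assms
  unfolding left_fdiff_def fdiff_def by (auto simp: add_ac Suc_diff_le)

lemma right_fdiff_indicator:
  assumes "\<beta> \<le> 1" "p = a + real j" "b = a + real k" "j \<le> k" "i < k"
  shows "right_fdiff b \<beta> (\<lambda>s. if s = p then 1 else 0) (a + real i)
    = (if j < i then 0 else if i = j then 1
       else weight (1 - \<beta>) (j - i) - weight (1 - \<beta>) (j - Suc i))"
  using right_fsum_indicator[of "1 - \<beta>" p a j b k i]
    right_fsum_indicator[of "1 - \<beta>" p a j b k "Suc i"] assms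
  unfolding right_fdiff_def fdiff_def by (auto simp: add_ac)

section \<open>Second-order expansion of the Lagrangian along a direction\<close>

text \<open>The mean value theorem, with the intermediate point located only by an absolute bound:
  this treats both signs of \<open>x\<close> and \<open>x = 0\<close> alike and is enough for
  passing to the limit.\<close>

lemma Taylor_first_order:
  fixes f :: "real \<Rightarrow> real"
  assumes "\<And>x. (f has_real_derivative f' x) (at x)"
  shows "\<exists>\<theta>. \<bar>\<theta> - c\<bar> \<le> \<bar>x\<bar> \<and> f (c + x) = f c + x * f' \<theta>"
proof (cases "x = 0")
  case False
  define d where "d m = (if m = 0 then f else f')" for m :: nat
  have "\<exists>t. (if c + x < c then c + x < t \<and> t < c else c < t \<and> t < c + x) \<and>
     f (c + x) = (\<Sum>m<1. d m c / fact m * (c + x - c) ^ m) + d 1 t / fact 1 * (c + x - c) ^ 1"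
    by (rule Taylor[where a = "c - \<bar>x\<bar>" and b = "c + \<bar>x\<bar>"]) (use assms False in \<open>auto simp: d_def\<close>)
  then obtain t where "(if c + x < c then c + x < t \<and> t < c else c < t \<and> t < c + x)"
      "f (c + x) = f c + x * f' t"
    by (auto simp: d_def mult.commute)
  then show ?thesis
    by (intro exI[of _ t]) (auto split: if_splits)
qed auto

lemma Taylor_second_order:
  fixes f :: "real \<Rightarrow> real"
  assumes "\<And>x. (f has_real_derivative f' x) (at x)" "\<And>x. (f' has_real_derivative f'' x) (at x)"
  shows "\<exists>\<theta>. \<bar>\<theta> - c\<bar> \<le> \<bar>x\<bar> \<and> f (c + x) = f c + x * f' c + x\<^sup>2 / 2 * f'' \<theta>"
proof (cases "x = 0")
  case False
  define d where "d m = (if m = 0 then f else if m = 1 then f' else f'')" for m :: nat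
  have d: "DERIV (d m) t :> d (Suc m) t" if "m < 2" for m t
    using that assms by (auto simp: d_def less_2_cases_iff)
  have "\<exists>t. (if c + x < c then c + x < t \<and> t < c else c < t \<and> t < c + x) \<and>
     f (c + x) = (\<Sum>m<2. d m c / fact m * (c + x - c) ^ m) + d 2 t / fact 2 * (c + x - c) ^ 2"
    by (rule Taylor[where a = "c - \<bar>x\<bar>" and b = "c + \<bar>x\<bar>"]) (use d False in \<open>auto simp: d_def[of 0]\<close>)
  then obtain t where "(if c + x < c then c + x < t \<and> t < c else c < t \<and> t < c + x)"
      "f (c + x) = f c + x * f' c + x\<^sup>2 / 2 * f'' t"
    by (auto simp: d_def numeral_2_eq_2 mult.commute)
  then show ?thesis
    by (intro exI[of _ t]) (auto split: if_splits)
qed auto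

lemma has_pd_u_deriv:
  assumes "has_pd_u T g" "t \<in> T"
  shows "((\<lambda>x. g t x v w) has_real_derivative pd_u g t u v w) (at u)"
  using assms unfolding has_pd_u_def pd_u_def by (simp add: DERIV_deriv_iff_field_differentiable)

lemma has_pd_v_deriv:
  assumes "has_pd_v T g" "t \<in> T"
  shows "((\<lambda>x. g t u x w) has_real_derivative pd_v g t u v w) (at v)"
  using assms unfolding has_pd_v_def pd_v_def by (simp add: DERIV_deriv_iff_field_differentiable)

lemma has_pd_w_deriv:
  assumes "has_pd_w T g" "t \<in> T"
  shows "((\<lambda>x. g t u v x) has_real_derivative pd_w g t u v w) (at w)"
  using assms unfolding has_pd_w_def pd_w_def by (simp add: DERIV_deriv_iff_field_differentiable)

text \<open>Continuity on \<open>T \<times> UNIV\<close>, restricted to the slice of a fixed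
  \<open>t\<close>, is joint continuity in the three real arguments.\<close>

lemma cont_lagr_tendsto:
  assumes "cont_lagr T g" "t \<in> T" "(p \<longlongrightarrow> u) F" "(q \<longlongrightarrow> v) F" "(r \<longlongrightarrow> w) F"
  shows "((\<lambda>h. g t (p h) (q h) (r h)) \<longlongrightarrow> g t u v w) F"
proof -
  have "continuous_on UNIV (\<lambda>(u, v, w). g t u v w)"
  proof -
    have "continuous_on UNIV ((\<lambda>(t, u, v, w). g t u v w) \<circ> (\<lambda>x. (t, x)))"
      by (rule continuous_on_compose)
        (use assms(1,2) in \<open>auto simp: cont_lagr_def intro!: continuous_intros
           elim: continuous_on_subset\<close>)
    then show ?thesis
      by (simp add: o_def)
  qed
  then have "isCont (\<lambda>(u, v, w). g t u v w) (u, v, w)"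
    by (simp add: continuous_on_eq_continuous_at)
  from isCont_tendsto_compose[OF this tendsto_Pair[OF assms(3) tendsto_Pair[OF assms(4,5)]]]
  show ?thesis
    by simp
qed

text \<open>Changing the arguments one at a time, last to first, involves exactly the mixed partials
\<open>L_uv\<close>, \<open>L_uw\<close>, \<open>L_vw\<close> that are assumed to exist.\<close>
lemma lagr_expansion:
  assumes "cont_second_partials T L" and t: "t \<in> T"
  shows "\<exists>p1 p2 p3 p4 p5 p6. \<bar>p1 - u\<bar> \<le> \<bar>x\<bar> \<and> \<bar>p2 - v\<bar> \<le> \<bar>y\<bar> \<and> \<bar>p3 - w\<bar> \<le> \<bar>z\<bar>
    \<and> \<bar>p4 - v\<bar> \<le> \<bar>y\<bar> \<and> \<bar>p5 - w\<bar> \<le> \<bar>z\<bar> \<and> \<bar>p6 - w\<bar> \<le> \<bar>z\<bar>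
    \<and> L t (u + x) (v + y) (w + z) = L t u v w
      + (x * pd_u L t u v w + y * pd_v L t u v w + z * pd_w L t u v w)
      + (x\<^sup>2 / 2 * pd_uu L t p1 (v + y) (w + z) + x * y * pd_uv L t u p2 (w + z)
         + x * z * pd_uw L t u v p3 + y\<^sup>2 / 2 * pd_vv L t u p4 (w + z)
         + y * z * pd_vw L t u v p5 + z\<^sup>2 / 2 * pd_ww L t u v p6)"
proof -
  note L = assms(1)[unfolded cont_second_partials_def]
  obtain p1 where p1: "\<bar>p1 - u\<bar> \<le> \<bar>x\<bar>" "L t (u + x) (v + y) (w + z) = L t u (v + y) (w + z)
      + x * pd_u L t u (v + y) (w + z) + x\<^sup>2 / 2 * pd_uu L t p1 (v + y) (w + z)"
    using Taylor_second_order[of "\<lambda>u. L t u (v + y) (w + z)" "\<lambda>u. pd_u L t u (v + y) (w + z)"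
        "\<lambda>u. pd_uu L t u (v + y) (w + z)"] L t has_pd_u_deriv by metis
  \<comment> \<open>The first-order coefficient \<open>pd_u L\<close> still sits at the shifted
    \<open>v\<close> and \<open>w\<close>; moving it back to the base point produces the mixed
    terms.\<close>
  obtain p2 where p2: "\<bar>p2 - v\<bar> \<le> \<bar>y\<bar>"
      "pd_u L t u (v + y) (w + z) = pd_u L t u v (w + z) + y * pd_uv L t u p2 (w + z)"
    using Taylor_first_order[of "\<lambda>v. pd_u L t u v (w + z)" "\<lambda>v. pd_uv L t u v (w + z)"]
      L t has_pd_v_deriv by metis
  obtain p3 where p3: "\<bar>p3 - w\<bar> \<le> \<bar>z\<bar>"
      "pd_u L t u v (w + z) = pd_u L t u v w + z * pd_uw L t u v p3"
    using Taylor_first_order[of "\<lambda>w. pd_u L t u v w" "\<lambda>w. pd_uw L t u v w"]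
      L t has_pd_w_deriv by metis
  obtain p4 where p4: "\<bar>p4 - v\<bar> \<le> \<bar>y\<bar>" "L t u (v + y) (w + z) = L t u v (w + z)
      + y * pd_v L t u v (w + z) + y\<^sup>2 / 2 * pd_vv L t u p4 (w + z)"
    using Taylor_second_order[of "\<lambda>v. L t u v (w + z)" "\<lambda>v. pd_v L t u v (w + z)"
        "\<lambda>v. pd_vv L t u v (w + z)"] L t has_pd_v_deriv by metis
  obtain p5 where p5: "\<bar>p5 - w\<bar> \<le> \<bar>z\<bar>"
      "pd_v L t u v (w + z) = pd_v L t u v w + z * pd_vw L t u v p5"
    using Taylor_first_order[of "\<lambda>w. pd_v L t u v w" "\<lambda>w. pd_vw L t u v w"]
      L t has_pd_w_deriv by metis
  obtain p6 where p6: "\<bar>p6 - w\<bar> \<le> \<bar>z\<bar>" "L t u v (w + z) = L t u v w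
      + z * pd_w L t u v w + z\<^sup>2 / 2 * pd_ww L t u v p6"
    using Taylor_second_order[of "\<lambda>w. L t u v w" "\<lambda>w. pd_w L t u v w" "\<lambda>w. pd_ww L t u v w"]
      L t has_pd_w_deriv by metis
  have "L t (u + x) (v + y) (w + z) = L t u v w
      + (x * pd_u L t u v w + y * pd_v L t u v w + z * pd_w L t u v w)
      + (x\<^sup>2 / 2 * pd_uu L t p1 (v + y) (w + z) + x * y * pd_uv L t u p2 (w + z)
         + x * z * pd_uw L t u v p3 + y\<^sup>2 / 2 * pd_vv L t u p4 (w + z)
         + y * z * pd_vw L t u v p5 + z\<^sup>2 / 2 * pd_ww L t u v p6)"
    unfolding p1(2) p2(2) p3(2) p4(2) p5(2) p6(2) by (simp add: algebra_simps)
  with p1(1) p2(1) p3(1) p4(1) p5(1) p6(1) show ?thesis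
    by blast
qed

text \<open>The Hessian form of \<open>L t\<close> in direction \<open>(x, y, z)\<close>, each mixed
  partial being taken in the one order assumed to exist and doubled.\<close>

definition lagr_hessian ::
  "lagrangian \<Rightarrow> real \<Rightarrow> real \<Rightarrow> real \<Rightarrow> real \<Rightarrow> real \<Rightarrow> real \<Rightarrow> real \<Rightarrow> real" where
  "lagr_hessian L t u v w x y z =
     x\<^sup>2 * pd_uu L t u v w + 2 * x * y * pd_uv L t u v w + 2 * x * z * pd_uw L t u v w
     + y\<^sup>2 * pd_vv L t u v w + 2 * y * z * pd_vw L t u v w + z\<^sup>2 * pd_ww L t u v w"

text \<open>After division by \<open>h\<^sup>2\<close> the expansion leaves second partials at
  intermediate points. These points are squeezed to the base point as \<open>h\<close> tends to 0,
  so continuity gives the limit.\<close>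

lemma lagr_remainder_tendsto:
  assumes "cont_second_partials T L" and t: "t \<in> T"
  shows "((\<lambda>h. (L t (u + h * x) (v + h * y) (w + h * z) - L t u v w
      - h * (x * pd_u L t u v w + y * pd_v L t u v w + z * pd_w L t u v w)) / h\<^sup>2)
    \<longlongrightarrow> lagr_hessian L t u v w x y z / 2) (at 0)"
proof -
  let ?D = "x * pd_u L t u v w + y * pd_v L t u v w + z * pd_w L t u v w"
  let ?E = "\<lambda>h p1 p2 p3 p4 p5 p6.
    x\<^sup>2 / 2 * pd_uu L t p1 (v + h * y) (w + h * z) + x * y * pd_uv L t u p2 (w + h * z)
         + x * z * pd_uw L t u v p3 + y\<^sup>2 / 2 * pd_vv L t u p4 (w + h * z)
         + y * z * pd_vw L t u v p5 + z\<^sup>2 / 2 * pd_ww L t u v p6"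
  have "\<forall>h. \<exists>p1 p2 p3 p4 p5 p6. \<bar>p1 - u\<bar> \<le> \<bar>h * x\<bar> \<and> \<bar>p2 - v\<bar> \<le> \<bar>h * y\<bar> \<and> \<bar>p3 - w\<bar> \<le> \<bar>h * z\<bar>
    \<and> \<bar>p4 - v\<bar> \<le> \<bar>h * y\<bar> \<and> \<bar>p5 - w\<bar> \<le> \<bar>h * z\<bar> \<and> \<bar>p6 - w\<bar> \<le> \<bar>h * z\<bar>
    \<and> L t (u + h * x) (v + h * y) (w + h * z) = L t u v w + h * ?D + h\<^sup>2 * ?E h p1 p2 p3 p4 p5 p6"
    (is "\<forall>h. \<exists>p1 p2 p3 p4 p5 p6. ?P h p1 p2 p3 p4 p5 p6")
  proof
    fix h
    show "\<exists>p1 p2 p3 p4 p5 p6. ?P h p1 p2 p3 p4 p5 p6"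
      using lagr_expansion[OF assms, of u "h * x" v "h * y" w "h * z"]
      by (elim ex_forward conj_forward)
        (simp_all add: power2_eq_square algebra_simps add_divide_distrib)
  qed
  \<comment> \<open>Choice turns the intermediate points into functions of \<open>h\<close>, so that
    their limits make sense.\<close>
  then obtain p1 p2 p3 p4 p5 p6 where p: "\<And>h. ?P h (p1 h) (p2 h) (p3 h) (p4 h) (p5 h) (p6 h)"
    unfolding choice_iff by (elim exE) (rule that, erule spec)
  have lim: "(q \<longlongrightarrow> c) (at 0)" if "\<And>h. \<bar>q h - c\<bar> \<le> \<bar>h * m\<bar>" for q :: "real \<Rightarrow> real" and c m
  proof -
    have "((\<lambda>h. \<bar>h * m\<bar>) \<longlongrightarrow> \<bar>0 * m\<bar>) (at 0)"
      by (intro tendsto_intros)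
    then have "((\<lambda>h. \<bar>h * m\<bar>) \<longlongrightarrow> 0) (at 0)"
      by simp
    then have "((\<lambda>h. q h - c) \<longlongrightarrow> 0) (at 0)"
      by (rule Lim_null_comparison[rotated]) (simp add: that)
    then show ?thesis
      by (simp add: LIM_zero_iff)
  qed
  have shift: "((\<lambda>h. c + h * m) \<longlongrightarrow> c) (at 0)" for c m :: real
    by (rule lim[of _ _ m]) simp
  have plims: "(p1 \<longlongrightarrow> u) (at 0)" "(p2 \<longlongrightarrow> v) (at 0)" "(p3 \<longlongrightarrow> w) (at 0)"
      "(p4 \<longlongrightarrow> v) (at 0)" "(p5 \<longlongrightarrow> w) (at 0)" "(p6 \<longlongrightarrow> w) (at 0)"
    using p by (blast intro: lim)+
  have cont: "cont_lagr T (pd_uu L)" "cont_lagr T (pd_uv L)" "cont_lagr T (pd_uw L)"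
      "cont_lagr T (pd_vv L)" "cont_lagr T (pd_vw L)" "cont_lagr T (pd_ww L)"
    using assms(1) unfolding cont_second_partials_def by simp_all
  have "((\<lambda>h. ?E h (p1 h) (p2 h) (p3 h) (p4 h) (p5 h) (p6 h)) \<longlongrightarrow>
     x\<^sup>2 / 2 * pd_uu L t u v w + x * y * pd_uv L t u v w
         + x * z * pd_uw L t u v w + y\<^sup>2 / 2 * pd_vv L t u v w
         + y * z * pd_vw L t u v w + z\<^sup>2 / 2 * pd_ww L t u v w) (at 0)"
    by (intro tendsto_add tendsto_mult tendsto_const cont[THEN cont_lagr_tendsto, OF t] shift plims)
  also have "x\<^sup>2 / 2 * pd_uu L t u v w + x * y * pd_uv L t u v w
         + x * z * pd_uw L t u v w + y\<^sup>2 / 2 * pd_vv L t u v w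
         + y * z * pd_vw L t u v w + z\<^sup>2 / 2 * pd_ww L t u v w = lagr_hessian L t u v w x y z / 2"
    by (simp add: lagr_hessian_def field_simps)
  finally show ?thesis
  proof (rule Lim_transform_eventually)
    have quotient: "e = (l - c - d) / h\<^sup>2" if "h \<noteq> 0" "l = c + d + h\<^sup>2 * e" for c d e h l :: real
      using that by simp
    show "\<forall>\<^sub>F h in at 0. ?E h (p1 h) (p2 h) (p3 h) (p4 h) (p5 h) (p6 h) =
      (L t (u + h * x) (v + h * y) (w + h * z) - L t u v w - h * ?D) / h\<^sup>2"
      using eventually_neq_at_within[of 0 0]
      by (rule eventually_mono, elim quotient) (use p in blast)
  qed
qed

text \<open>Adding the remainders for opposite directions cancels the first-order terms and doubles
  the even quadratic form.\<close>

lemma lagr_second_difference_tendsto: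
  assumes "cont_second_partials T L" and "t \<in> T"
  shows "((\<lambda>h. (L t (u + h * x) (v + h * y) (w + h * z) + L t (u - h * x) (v - h * y) (w - h * z)
      - 2 * L t u v w) / h\<^sup>2) \<longlongrightarrow> lagr_hessian L t u v w x y z) (at 0)"
proof -
  have "((\<lambda>h. (L t (u - h * x) (v - h * y) (w - h * z) - L t u v w
      + h * (x * pd_u L t u v w + y * pd_v L t u v w + z * pd_w L t u v w)) / h\<^sup>2)
    \<longlongrightarrow> lagr_hessian L t u v w x y z / 2) (at 0)"
    using lagr_remainder_tendsto[OF assms, of u "-x" v "-y" w "-z"]
    by (simp add: lagr_hessian_def algebra_simps)
  from tendsto_add[OF lagr_remainder_tendsto[OF assms, of u x v y w z] this] show ?thesis
    by (simp add: add_divide_distrib[symmetric] algebra_simps)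
qed

section \<open>Nonnegativity of the second variation\<close>

lemma at_traj_add_mult:
  "at_traj a b \<alpha> \<beta> L (\<lambda>t. y t + h * \<eta> t) t
    = L t (y (\<sigma> t) + h * \<eta> (\<sigma> t)) (left_fdiff a \<alpha> y t + h * left_fdiff a \<alpha> \<eta> t)
       (right_fdiff b \<beta> y t + h * right_fdiff b \<beta> \<eta> t)"
  unfolding at_traj_def left_fdiff_add left_fdiff_mult right_fdiff_add right_fdiff_mult ..

text \<open>Both \<open>y + h * \<eta>\<close> and \<open>y - h * \<eta>\<close> are admissible and
  near \<open>y\<close> for small \<open>h\<close>, so the second difference of the functional is
  nonnegative, and so is the limit of its quotient by \<open>h\<^sup>2\<close>.\<close>

lemma second_variation_nonneg:
  assumes L: "cont_second_partials (steps a (b - 1)) L"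
    and fin: "finite (steps a (b - 1))" "steps a (b - 1) \<noteq> {}"
    and min: "local_minimizer a b \<alpha> \<beta> L A B y"
    and \<eta>: "\<eta> a = 0" "\<eta> b = 0"
  shows "0 \<le> (\<Sum>t\<in>steps a (b - 1). lagr_hessian L t (y (\<sigma> t)) (left_fdiff a \<alpha> y t)
     (right_fdiff b \<beta> y t) (\<eta> (\<sigma> t)) (left_fdiff a \<alpha> \<eta> t) (right_fdiff b \<beta> \<eta> t))"
    (is "0 \<le> ?Q")
proof -
  let ?F = "\<lambda>h. functional a b \<alpha> \<beta> L (\<lambda>t. y t + h * \<eta> t)"
  have "((\<lambda>h. \<Sum>t\<in>steps a (b - 1). (at_traj a b \<alpha> \<beta> L (\<lambda>t. y t + h * \<eta> t) t
      + at_traj a b \<alpha> \<beta> L (\<lambda>t. y t + (- h) * \<eta> t) t - 2 * at_traj a b \<alpha> \<beta> L y t) / h\<^sup>2) \<longlongrightarrow> ?Q) (at 0)"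
    unfolding at_traj_add_mult at_traj_def
    using lagr_second_difference_tendsto[OF L]
    by (intro tendsto_sum) simp
  then have lim: "((\<lambda>h. (?F h + ?F (- h) - 2 * functional a b \<alpha> \<beta> L y) / h\<^sup>2) \<longlongrightarrow> ?Q) (at 0)"
    by (simp add: functional_def sum.distrib sum_subtractf sum_distrib_left
        flip: sum_divide_distrib)
  obtain \<delta> where \<delta>: "\<delta> > 0" and le: "\<And>z. z a = A \<Longrightarrow> z b = B \<Longrightarrow>
      fnorm a b \<alpha> \<beta> (\<lambda>t. z t - y t) < \<delta> \<Longrightarrow> functional a b \<alpha> \<beta> L y \<le> functional a b \<alpha> \<beta> L z"
    and y: "y a = A" "y b = B"
    using min unfolding local_minimizer_def by blast
  have F: "functional a b \<alpha> \<beta> L y \<le> ?F h" if "\<bar>h\<bar> * fnorm a b \<alpha> \<beta> \<eta> < \<delta>" for h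
    by (rule le) (use that \<eta> y fnorm_mult[OF fin, of \<alpha> \<beta> h \<eta>] in simp_all)
  have "((\<lambda>h. \<bar>h\<bar> * fnorm a b \<alpha> \<beta> \<eta>) \<longlongrightarrow> \<bar>0\<bar> * fnorm a b \<alpha> \<beta> \<eta>) (at (0::real))"
    by (intro tendsto_intros)
  then have "\<forall>\<^sub>F h in at (0::real). \<bar>h\<bar> * fnorm a b \<alpha> \<beta> \<eta> < \<delta>"
    by (rule order_tendstoD) (use \<delta> in simp)
  then have "\<forall>\<^sub>F h in at 0. 0 \<le> (?F h + ?F (- h) - 2 * functional a b \<alpha> \<beta> L y) / h\<^sup>2"
  proof eventually_elim
    case (elim h)
    \<comment> \<open>The smallness condition depends only on \<open>\<bar>h\<bar>\<close> and thus
      covers both signs.\<close>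
    with F[of h] F[of "- h"] show ?case
      by simp
  qed
  with lim show ?thesis
    by (rule tendsto_lowerbound) (rule at_neq_bot)
qed

section \<open>Evaluation of the second variation at the indicator\<close>

lemma sum_lessThan_add:
  fixes f :: "nat \<Rightarrow> 'a :: comm_monoid_add"
  shows "(\<Sum>i<m + n. f i) = (\<Sum>i<m. f i) + (\<Sum>i<n. f (m + i))"
  by (induction n) (simp_all add: add_ac)

theorem theorem3p6:
  fixes a b \<alpha> \<beta> \<mu> \<nu> A B :: real
    and k :: nat
    and L :: "real \<Rightarrow> real \<Rightarrow> real \<Rightarrow> real \<Rightarrow> real"
    and yt :: "real \<Rightarrow> real"
  assumes "k \<ge> 2" and "b = a + real k"
    and "0 < \<alpha>" "\<alpha> \<le> 1" and "0 < \<beta>" "\<beta> \<le> 1"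
    and "\<mu> = 1 - \<alpha>" and "\<nu> = 1 - \<beta>"
    and "cont_second_partials (steps a (b - 1)) L"
    and "local_minimizer a b \<alpha> \<beta> L A B yt"
  shows "\<forall>t\<in>steps a (b - 2).
    (let Luu = at_traj a b \<alpha> \<beta> (pd_uu L) yt; Luv = at_traj a b \<alpha> \<beta> (pd_uv L) yt;
         Luw = at_traj a b \<alpha> \<beta> (pd_uw L) yt; Lvv = at_traj a b \<alpha> \<beta> (pd_vv L) yt;
         Lvw = at_traj a b \<alpha> \<beta> (pd_vw L) yt; Lww = at_traj a b \<alpha> \<beta> (pd_ww L) yt
     in Luu t + 2 * Luv t + Lvv t + Lvv (\<sigma> t) * (\<mu> - 1)\<^sup>2
        + (\<Sum>s\<in>steps (\<sigma> (\<sigma> t)) (b - 1).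
             Lvv s * (\<mu> * (\<mu> - 1) * (\<Prod>i\<in>steps 0 (s - t - 3). \<mu> + i + 1)
                      / ((s - t) * Gamma (s - t)))\<^sup>2)
        + 2 * Luw t * (\<nu> - 1)
        + 2 * (\<nu> - 1) * Lvw t + 2 * (\<mu> - 1) * Lvw (\<sigma> t)
        + Lww t * (1 - \<nu>)\<^sup>2 + Lww (\<sigma> t)
        + (\<Sum>s\<in>steps a (t - 1).
             Lww s * (\<nu> * (1 - \<nu>) * (\<Prod>i\<in>steps 0 (t - s - 2). \<nu> + i + 1)
                      / ((\<sigma> t - s) * Gamma (\<sigma> t - s)))\<^sup>2)
        \<ge> 0)"
proof
  fix t
  assume "t \<in> steps a (b - 2)"
  then obtain j where t: "t = a + real j" and "a + real j \<le> b - 2"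
    by (auto simp: steps_def)
  then have "real (j + 2) \<le> real k"
    using assms(2) by simp
  then have j: "j + 2 \<le> k"
    by (simp only: of_nat_le_iff)
  \<comment> \<open>The number of points after \<open>\<sigma> t\<close> up to \<open>b - 1\<close>;
    it is 0 when \<open>t = b - 2\<close>.\<close>
  define m where "m = k - (j + 2)"
  have k: "k = j + 2 + m"
    using j by (simp add: m_def)
  define p where "p = a + real (Suc j)"
  define \<eta> :: "real \<Rightarrow> real" where "\<eta> s = (if s = p then 1 else 0)" for s
  define Luu Luv Luw Lvv Lvw Lww where L:
    "Luu = at_traj a b \<alpha> \<beta> (pd_uu L) yt" "Luv = at_traj a b \<alpha> \<beta> (pd_uv L) yt"
    "Luw = at_traj a b \<alpha> \<beta> (pd_uw L) yt" "Lvv = at_traj a b \<alpha> \<beta> (pd_vv L) yt"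
    "Lvw = at_traj a b \<alpha> \<beta> (pd_vw L) yt" "Lww = at_traj a b \<alpha> \<beta> (pd_ww L) yt"
  define q where "q s = lagr_hessian L s (yt (\<sigma> s)) (left_fdiff a \<alpha> yt s)
     (right_fdiff b \<beta> yt s) (\<eta> (\<sigma> s)) (left_fdiff a \<alpha> \<eta> s) (right_fdiff b \<beta> \<eta> s)" for s
  have q: "q s = (\<eta> (\<sigma> s))\<^sup>2 * Luu s + 2 * \<eta> (\<sigma> s) * left_fdiff a \<alpha> \<eta> s * Luv s
     + 2 * \<eta> (\<sigma> s) * right_fdiff b \<beta> \<eta> s * Luw s + (left_fdiff a \<alpha> \<eta> s)\<^sup>2 * Lvv s
     + 2 * left_fdiff a \<alpha> \<eta> s * right_fdiff b \<beta> \<eta> s * Lvw s + (right_fdiff b \<beta> \<eta> s)\<^sup>2 * Lww s" for s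
    by (simp add: q_def lagr_hessian_def L at_traj_def)
  have steps: "b - 1 = a + real k - 1"
    using assms(2) by simp
  \<comment> \<open>Gives \<open>\<eta> b = 0\<close>; the form \<open>1 + real j\<close> is what
    \<open>real (Suc j)\<close> simplifies to.\<close>
  have b_noteq: "b \<noteq> a + (1 + real j)"
    using assms(2) j by simp
  have "0 \<le> sum q (steps a (b - 1))"
    unfolding q_def
    by (rule second_variation_nonneg[OF assms(9) _ _ assms(10)])
      (use assms(1) j b_noteq in \<open>simp_all add: steps_conv[OF steps] \<eta>_def p_def lessThan_empty_iff\<close>)
  also have "\<dots> = (\<Sum>i<j + 2 + m. q (a + real i))"
    unfolding sum_steps[OF steps] k ..
  \<comment> \<open>Before \<open>t\<close> only the right difference of \<eta> can be nonzero,
    leaving \<open>Lww\<close>; after \<open>\<sigma> t\<close> only the left one can, leaving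
    \<open>Lvv\<close>. Cross terms occur only at \<open>t\<close> and
    \<open>\<sigma> t\<close>.\<close>
  also have "\<dots> = (\<Sum>i<j. q (a + real i)) + q t + q (\<sigma> t) + (\<Sum>i<m. q (a + real (j + 2 + i)))"
    unfolding sum_lessThan_add t by (simp add: numeral_2_eq_2 add_ac)
  finally have sum: "0 \<le> \<dots>" .
  have u: "\<eta> (\<sigma> (a + real i)) = (if i = j then 1 else 0)" for i
    by (auto simp: \<eta>_def p_def)
  have v: "left_fdiff a \<alpha> \<eta> (a + real i) = (if i < j then 0 else if i = j then 1
       else weight \<mu> (Suc (i - Suc j)) - weight \<mu> (i - Suc j))" for i
    unfolding \<eta>_def[abs_def] assms(7) using left_fdiff_indicator[OF assms(4) p_def] by auto
  have w: "right_fdiff b \<beta> \<eta> (a + real i) = (if Suc j < i then 0 else if i = Suc j then 1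
       else weight \<nu> (Suc j - i) - weight \<nu> (j - i))" if "i < k" for i
    unfolding \<eta>_def[abs_def] assms(8)
    using right_fdiff_indicator[OF assms(6) p_def assms(2) _ that] j by auto
  have w1: "weight x (Suc 0) = x" for x
    by (simp add: weight_def)
  have wt: "right_fdiff b \<beta> \<eta> (a + real j) = \<nu> - 1"
    using w[of j] j by (simp add: w1)
  have qt: "q t = Luu t + 2 * Luv t + Lvv t + 2 * Luw t * (\<nu> - 1) + 2 * (\<nu> - 1) * Lvw t
     + Lww t * (1 - \<nu>)\<^sup>2"
    unfolding q t u v wt by (simp add: power2_eq_square algebra_simps)
  have \<sigma>t: "\<sigma> t = a + real (Suc j)"
    by (simp add: t)
  have qs: "q (\<sigma> t) = Lvv (\<sigma> t) * (\<mu> - 1)\<^sup>2 + 2 * (\<mu> - 1) * Lvw (\<sigma> t) + Lww (\<sigma> t)"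
    unfolding q \<sigma>t u v using w[of "Suc j"] j
    by (simp add: w1 power2_eq_square algebra_simps)
  have left: "(\<Sum>i<j. q (a + real i)) = (\<Sum>s\<in>steps a (t - 1).
             Lww s * (\<nu> * (1 - \<nu>) * (\<Prod>i\<in>steps 0 (t - s - 2). \<nu> + i + 1)
                      / ((\<sigma> t - s) * Gamma (\<sigma> t - s)))\<^sup>2)"
    unfolding sum_steps[of "t - 1" a j, OF arg_cong[OF t, of "\<lambda>x. x - 1"]]
  proof (rule sum.cong)
    fix i
    assume "i \<in> {..<j}"
    then obtain n where n: "j = i + Suc n"
      by (auto dest: less_imp_Suc_add)
    let ?s = "a + real i"
    let ?c = "\<nu> * (\<nu> - 1) * (\<Prod>i\<in>steps 0 (t - ?s - 2). \<nu> + i + 1) / ((\<sigma> t - ?s) * Gamma (\<sigma> t - ?s))"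
    \<comment> \<open>The distance from \<open>?s\<close> to \<open>p\<close> is
      \<open>n + 2\<close>, so \<open>\<sigma> t - ?s = n + 2\<close> and
      \<open>t - ?s - 2 = n - 1\<close> fit \<open>weight_diff_prod\<close>.\<close>
    have "right_fdiff b \<beta> \<eta> ?s = weight \<nu> (Suc (Suc n)) - weight \<nu> (Suc n)"
      using w[of i] n j by (simp add: Suc_diff_le)
    also have "\<dots> = ?c"
      by (rule weight_diff_prod) (simp_all add: t n)
    finally have "q ?s = Lww ?s * ?c\<^sup>2"
      unfolding q u v using n by (simp add: mult.commute)
    \<comment> \<open>The increment carries \<open>\<nu> - 1\<close> where the claim has
      \<open>1 - \<nu>\<close>; squaring absorbs the sign.\<close>
    also have "?c\<^sup>2 = (\<nu> * (1 - \<nu>) * (\<Prod>i\<in>steps 0 (t - ?s - 2). \<nu> + i + 1)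
        / ((\<sigma> t - ?s) * Gamma (\<sigma> t - ?s)))\<^sup>2"
      by (simp only: power_divide power_mult_distrib power2_commute[of \<nu> 1])
    finally show "q ?s = Lww ?s * (\<nu> * (1 - \<nu>) * (\<Prod>i\<in>steps 0 (t - ?s - 2). \<nu> + i + 1)
        / ((\<sigma> t - ?s) * Gamma (\<sigma> t - ?s)))\<^sup>2" .
  qed simp
  have "b - 1 = \<sigma> (\<sigma> t) + real m - 1"
    by (simp add: assms(2) t k)
  note steps2 = sum_steps[OF this]
  have right: "(\<Sum>i<m. q (a + real (j + 2 + i))) = (\<Sum>s\<in>steps (\<sigma> (\<sigma> t)) (b - 1).
             Lvv s * (\<mu> * (\<mu> - 1) * (\<Prod>i\<in>steps 0 (s - t - 3). \<mu> + i + 1)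
                      / ((s - t) * Gamma (s - t)))\<^sup>2)"
    unfolding steps2
  proof (rule sum.cong)
    fix n
    assume n: "n \<in> {..<m}"
    let ?s = "\<sigma> (\<sigma> t) + real n"
    let ?c = "\<mu> * (\<mu> - 1) * (\<Prod>i\<in>steps 0 (?s - t - 3). \<mu> + i + 1) / ((?s - t) * Gamma (?s - t))"
    have s: "?s = a + real (j + 2 + n)"
      by (simp add: t)
    \<comment> \<open>Here \<open>?s - t = n + 2\<close>, while \<open>?s\<close> lies
      \<open>n + 1\<close> steps after \<open>p\<close>; the left difference looks one step ahead,
      hence the weights of index \<open>n + 2\<close> and \<open>n + 1\<close>.\<close>
    have "left_fdiff a \<alpha> \<eta> ?s = weight \<mu> (Suc (Suc n)) - weight \<mu> (Suc n)"
      unfolding s v by simp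
    also have "\<dots> = ?c"
      by (rule weight_diff_prod) simp_all
    finally have "left_fdiff a \<alpha> \<eta> ?s = ?c" .
    moreover have "\<eta> (\<sigma> ?s) = 0" "right_fdiff b \<beta> \<eta> ?s = 0"
      unfolding s u using w[of "j + 2 + n"] n k by simp_all
    ultimately have "q ?s = Lvv ?s * ?c\<^sup>2"
      unfolding q by simp
    then show "q (a + real (j + 2 + n)) = Lvv ?s * ?c\<^sup>2"
      unfolding s .
  qed simp
  show "let Luu = at_traj a b \<alpha> \<beta> (pd_uu L) yt; Luv = at_traj a b \<alpha> \<beta> (pd_uv L) yt;
         Luw = at_traj a b \<alpha> \<beta> (pd_uw L) yt; Lvv = at_traj a b \<alpha> \<beta> (pd_vv L) yt;
         Lvw = at_traj a b \<alpha> \<beta> (pd_vw L) yt; Lww = at_traj a b \<alpha> \<beta> (pd_ww L) yt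
     in Luu t + 2 * Luv t + Lvv t + Lvv (\<sigma> t) * (\<mu> - 1)\<^sup>2
        + (\<Sum>s\<in>steps (\<sigma> (\<sigma> t)) (b - 1).
             Lvv s * (\<mu> * (\<mu> - 1) * (\<Prod>i\<in>steps 0 (s - t - 3). \<mu> + i + 1)
                      / ((s - t) * Gamma (s - t)))\<^sup>2)
        + 2 * Luw t * (\<nu> - 1)
        + 2 * (\<nu> - 1) * Lvw t + 2 * (\<mu> - 1) * Lvw (\<sigma> t)
        + Lww t * (1 - \<nu>)\<^sup>2 + Lww (\<sigma> t)
        + (\<Sum>s\<in>steps a (t - 1).
             Lww s * (\<nu> * (1 - \<nu>) * (\<Prod>i\<in>steps 0 (t - s - 2). \<nu> + i + 1)
                      / ((\<sigma> t - s) * Gamma (\<sigma> t - s)))\<^sup>2)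
        \<ge> 0"
    unfolding Let_def L[symmetric] using sum unfolding qt qs left right
    by linarith
qed

end
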